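(* Let $\mathcal{U}$ and $\mathcal{M}$ be real separable Hilbert spaces, let $\nu_M$ be a probability measure on $\mathcal{M}$, let $p\in[2,\infty]$, and let $\mathcal{F},\widetilde{\mathcal{F}}\in L^p(\mathcal{M},\nu_M;\mathcal{U})$. Put $\mathcal{E}(m):=\mathcal{F}(m)-\widetilde{\mathcal{F}}(m)$ for $\nu_M$-almost every $m$. Let $\mathcal{B}:\mathcal{U}\to\mathbb{R}^{n_y}$ be a (possibly nonlinear) observation operator such that, for some constants $c_B,\widetilde{c_B},c_L>0$ and for $\nu_M$-almost every $m\in\mathcal{M}$, $$\|(\mathcal{B}\circ\mathcal{F})(m)\|_2\le c_B\|\mathcal{F}(m)\|_{\mathcal{U}},\qquad \|(\mathcal{B}\circ\widetilde{\mathcal{F}})(m)\|_2\le \widetilde{c_B}\|\mathcal{F}(m)\|_{\mathcal{U}},\qquad \|(\mathcal{B}\circ\mathcal{F})(m)-(\mathcal{B}\circ\widetilde{\mathcal{F}})(m)\|_2\le c_L\|\mathcal{E}(m)\|_{\mathcal{U}}.$$ Let the noise distribution be the normal distribution $\mathcal{N}(\boldsymbol{0},\boldsymbol{C}_{\boldsymbol{N}})$ on $\mathbb{R}^{n_y}$, with $\boldsymbol{C}_{\boldsymbol{N}}$ symmetric positive definite. Let $\boldsymbol{y}^*\in\mathbb{R}^{n_y}$ be a given set of observation data. Let $\nu_{M|\boldsymbol{Y}}(\cdot|\boldsymbol{y}^* )$ and $\widetilde{\nu_{M|\boldsymbol{Y}}}(\cdot|\boldsymbol{y}^* )$ be the posterior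 distributions defined by Bayes' rule with prior $\nu_M$ and forward operators $\mathcal{F}$ and $\widetilde{\mathcal{F}}$, respectively (see context), and assume that these two posteriors and $\nu_M$ are mutually absolutely continuous. Let $$\mathcal{E}_{\mathrm{post}}:=D_{KL}\big(\widetilde{\nu_{M|\boldsymbol{Y}}}(\cdot|\boldsymbol{y}^* )\,\big\|\,\nu_{M|\boldsymbol{Y}}(\cdot|\boldsymbol{y}^* )\big).$$ Then $$\mathcal{E}_{\mathrm{post}}\le c_{\mathrm{BIP}}\,\|\mathcal{E}\|_{L^p(\mathcal{M},\nu_M;\mathcal{U})},\qquad c_{\mathrm{BIP}}=c_1\big(c_2(1)+c_3(p)\big)c_L,$$ where the constants $c_1,c_2,c_3>0$ are defined by $$c_1=\tfrac12\left\|\boldsymbol{C}_{\boldsymbol{N}}^{-1}\big((\mathcal{B}\circ\mathcal{F})(\cdot)+(\mathcal{B}\circ\widetilde{\mathcal{F}})(\cdot)-2\boldsymbol{y}^*\big)\right\|_{L^p(\mathcal{M},\nu_M;\mathbb{R}^{n_y})},$$ $$c_2(s)=\left\|\exp\left(-\tfrac12\big\|\boldsymbol{y}^*-(\mathcal{B}\circ\widetilde{\mathcal{F}})(\cdot)\big\|^2_{\boldsymbol{C}_{\boldsymbol{N}}^{-1}}\right)\right\|^{-1}_{L^s(\mathcal{M},\nu_M)}\quad (s\in[1,\infty]),$$ $$c_3(p)=\frac{c_2(1)}{c_2(q)}\in[1,c_2(1)],\qquad q=\begin{cases}\infty,&p=2,\\ p/(p-2),&p\in(2,\infty),\\ 1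,&p=\infty.\end{cases}$$
   Context: Bochner norms: for a Hilbert space $\mathcal{X}$ and $\mathcal{G}:\mathcal{M}\to\mathcal{X}$, $\|\mathcal{G}\|_{L^p(\mathcal{M},\nu_M;\mathcal{X})}=\big(\mathbb{E}_{M\sim\nu_M}[\|\mathcal{G}(M)\|_{\mathcal{X}}^p]\big)^{1/p}$ for $p\in[1,\infty)$, and it equals $\operatorname{ess\,sup}_{M\sim\nu_M}\|\mathcal{G}(M)\|_{\mathcal{X}}$ for $p=\infty$. $L^p(\mathcal{M},\nu_M)$ denotes the real-valued case. $\|\cdot\|_2$ is the Euclidean norm on $\mathbb{R}^{n_y}$, and $\|\boldsymbol{x}\|_{\boldsymbol{C}_{\boldsymbol{N}}^{-1}}^2=\boldsymbol{x}^T\boldsymbol{C}_{\boldsymbol{N}}^{-1}\boldsymbol{x}$. Setting: $\mathcal{F}$ is the true forward operator (parameter-to-state map) and $\widetilde{\mathcal{F}}$ is an approximation of it (for instance a trained neural operator); data are modelled as $\boldsymbol{Y}=(\mathcal{B}\circ\mathcal{F})(M)+\boldsymbol{N}$ with $M\sim\nu_M$ and additive noise $\boldsymbol{N}\sim\mathcal{N}(\boldsymbol{0},\boldsymbol{C}_{\boldsymbol{N}})$. Noise density: $\pi_{\boldsymbol{N}}(\boldsymbol{x})=\big((2\pi)^{n_y}\det\boldsymbol{C}_{\boldsymbol{N}}\big)^{-1/2}\exp\big(-\tfrac12\boldsymbol{x}^T\boldsymbol{C}_{\boldsymbol{N}}^{-1}\boldsymbol{x}\big)$. Bayes' rule: with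 likelihoods $\mathcal{L}(m;\boldsymbol{y}^* )=\pi_{\boldsymbol{N}}(\boldsymbol{y}^*-(\mathcal{B}\circ\mathcal{F})(m))$ and $\widetilde{\mathcal{L}}(m;\boldsymbol{y}^* )=\pi_{\boldsymbol{N}}(\boldsymbol{y}^*-(\mathcal{B}\circ\widetilde{\mathcal{F}})(m))$, and normalizing constants $Z(\boldsymbol{y}^* )=\mathbb{E}_{M\sim\nu_M}[\mathcal{L}(M;\boldsymbol{y}^* )]$ and $\widetilde{Z}(\boldsymbol{y}^* )=\mathbb{E}_{M\sim\nu_M}[\widetilde{\mathcal{L}}(M;\boldsymbol{y}^* )]$, the posteriors are the probability measures on $\mathcal{M}$ with $$\frac{d\nu_{M|\boldsymbol{Y}}(\cdot|\boldsymbol{y}^* )}{d\nu_M}(m)=\frac{\mathcal{L}(m;\boldsymbol{y}^* )}{Z(\boldsymbol{y}^* )},\qquad \frac{d\widetilde{\nu_{M|\boldsymbol{Y}}}(\cdot|\boldsymbol{y}^* )}{d\nu_M}(m)=\frac{\widetilde{\mathcal{L}}(m;\boldsymbol{y}^* )}{\widetilde{Z}(\boldsymbol{y}^* )}\qquad\text{a.s.}$$ Kullback–Leibler divergence: $D_{KL}(\mu\|\nu)=\mathbb{E}_{M\sim\mu}\big[\ln\big(\tfrac{d\mu}{d\nu}(M)\big)\big]$.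
   Formalization: The positivity of c_1 is claimed only when B∘F + B∘F̃ = 2y* does not hold almost everywhere; in that degenerate case c_1 = 0 (e.g. F = F̃ = 1, B the identity, y* = 1), so the claim c_1 > 0 fails there. The inequality itself is unrestricted. *)

theory Defs
  imports "HOL-Probability.Probability"
begin

text \<open>
  \<open>L\<^sup>p\<close> spaces with exponent \<open>p \<in> [1, \<infinity>]\<close>, given as an \<^typ>\<open>ereal\<close>. The elements are
  Borel measurable representatives; for a separable target space Borel measurability and strong
  measurability agree. \<open>Lp_norm\<close> is meaningful only for functions in \<open>Lp_space\<close>, because the
  Bochner integral and \<^const>\<open>real_of_ereal\<close> return 0 on divergent arguments.
\<close>

definition Lp_norm :: "ereal \<Rightarrow> 'a measure \<Rightarrow> ('a \<Rightarrow> 'b::real_normed_vector) \<Rightarrow> real" where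
  "Lp_norm p \<nu> G =
    (if p = \<infinity> then real_of_ereal (esssup \<nu> (\<lambda>m. ereal (norm (G m))))
     else (\<integral>m. norm (G m) powr real_of_ereal p \<partial>\<nu>) powr (1 / real_of_ereal p))"

definition Lp_space :: "ereal \<Rightarrow> 'a measure \<Rightarrow> ('a \<Rightarrow> 'b::real_normed_vector) set" where
  "Lp_space p \<nu> =
    {G \<in> borel_measurable \<nu>.
       if p = \<infinity> then esssup \<nu> (\<lambda>m. ereal (norm (G m))) < \<infinity>
       else integrable \<nu> (\<lambda>m. norm (G m) powr real_of_ereal p)}"

definition symmetric_pos_def :: "real^'n^'n \<Rightarrow> bool" where
  "symmetric_pos_def C \<longleftrightarrow> transpose C = C \<and> (\<forall>x. x \<noteq> 0 \<longrightarrow> 0 < x \<bullet> (C *v x))"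

definition sq_norm_inv :: "real^'n^'n \<Rightarrow> real^'n \<Rightarrow> real" where
  "sq_norm_inv C x = x \<bullet> (matrix_inv C *v x)"

definition noise_density :: "real^'n^'n \<Rightarrow> real^'n \<Rightarrow> real" where
  "noise_density C x =
    ((2 * pi) ^ CARD('n) * det C) powr (- 1 / 2) * exp (- (1 / 2) * sq_norm_inv C x)"

text \<open>
  In the following \<open>G\<close> and \<open>Gt\<close> are parameter-to-observable maps, i.e. the composition of the
  observation operator with the true, respectively approximate, forward operator.
\<close>

definition likelihood :: "real^'n^'n \<Rightarrow> ('m \<Rightarrow> real^'n) \<Rightarrow> real^'n \<Rightarrow> 'm \<Rightarrow> real" where
  "likelihood C G y m = noise_density C (y - G m)"

definition evidence :: "'m measure \<Rightarrow> real^'n^'n \<Rightarrow> ('m \<Rightarrow> real^'n) \<Rightarrow> real^'n \<Rightarrow> real" where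
  "evidence \<nu> C G y = (\<integral>m. likelihood C G y m \<partial>\<nu>)"

definition posterior :: "'m measure \<Rightarrow> real^'n^'n \<Rightarrow> ('m \<Rightarrow> real^'n) \<Rightarrow> real^'n \<Rightarrow> 'm measure" where
  "posterior \<nu> C G y = density \<nu> (\<lambda>m. ennreal (likelihood C G y m / evidence \<nu> C G y))"

definition mutually_absolutely_continuous :: "'a measure \<Rightarrow> 'a measure \<Rightarrow> bool" where
  "mutually_absolutely_continuous \<mu> \<nu> \<longleftrightarrow> absolutely_continuous \<mu> \<nu> \<and> absolutely_continuous \<nu> \<mu>"

text \<open>
  \<^const>\<open>KL_divergence\<close> takes the reference measure first: \<open>KL_divergence b \<nu> \<mu>\<close> is the
  \<open>\<mu>\<close>-expectation of \<open>log b (d\<mu>/d\<nu>)\<close>, so the arguments are swapped here, and base \<open>exp 1\<close>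
  gives the natural logarithm.
\<close>

definition D_KL :: "'a measure \<Rightarrow> 'a measure \<Rightarrow> real" where
  "D_KL \<mu> \<nu> = KL_divergence (exp 1) \<nu> \<mu>"

definition c1 :: "'m measure \<Rightarrow> real^'n^'n \<Rightarrow> ('m \<Rightarrow> real^'n) \<Rightarrow> ('m \<Rightarrow> real^'n) \<Rightarrow> real^'n \<Rightarrow>
    ereal \<Rightarrow> real" where
  "c1 \<nu> C G Gt y p =
    1 / 2 * Lp_norm p \<nu> (\<lambda>m. matrix_inv C *v (G m + Gt m - 2 *\<^sub>R y))"

definition c2 :: "'m measure \<Rightarrow> real^'n^'n \<Rightarrow> ('m \<Rightarrow> real^'n) \<Rightarrow> real^'n \<Rightarrow> ereal \<Rightarrow> real" where
  "c2 \<nu> C Gt y s = inverse (Lp_norm s \<nu> (\<lambda>m. exp (- (1 / 2) * sq_norm_inv C (y - Gt m))))"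

definition q_exponent :: "ereal \<Rightarrow> ereal" where
  "q_exponent p = (if p = 2 then \<infinity> else if p = \<infinity> then 1 else p / (p - 2))"

definition c3 :: "'m measure \<Rightarrow> real^'n^'n \<Rightarrow> ('m \<Rightarrow> real^'n) \<Rightarrow> real^'n \<Rightarrow> ereal \<Rightarrow> real" where
  "c3 \<nu> C Gt y p = c2 \<nu> C Gt y 1 / c2 \<nu> C Gt y (q_exponent p)"

definition c_BIP :: "'m measure \<Rightarrow> real^'n^'n \<Rightarrow> ('m \<Rightarrow> real^'n) \<Rightarrow> ('m \<Rightarrow> real^'n) \<Rightarrow> real^'n \<Rightarrow>
    real \<Rightarrow> ereal \<Rightarrow> real" where
  "c_BIP \<nu> C G Gt y cL p =
    c1 \<nu> C G Gt y p * (c2 \<nu> C Gt y 1 + c3 \<nu> C Gt y p) * cL"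

end

theory Submission
  imports Defs
begin

text \<open>
  Write \<open>G = B \<circ> F\<close>, \<open>Gt = B \<circ> Ft\<close> and let \<open>\<Phi>\<close>, \<open>\<Psi>\<close> be the potentials
  \<open>1/2 * sq_norm_inv C (y - G m)\<close> and \<open>1/2 * sq_norm_inv C (y - Gt m)\<close>. The normalization of the
  Gaussian cancels in Bayes' rule, so the two posteriors are the Gibbs measures with densities
  \<open>exp (- \<Phi>) / a\<close> and \<open>exp (- \<Psi>) / b\<close> (\<open>posterior_eq_density_exp\<close>). The logarithm of their
  ratio is \<open>\<Phi> - \<Psi> + ln a - ln b\<close>, and therefore the divergence is the expectation of
  \<open>\<Phi> - \<Psi>\<close> under the approximate posterior plus \<open>ln a - ln b\<close>. As \<open>ln a - ln b \<le> (a - b) / b\<close>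
  and \<open>t \<mapsto> exp (- t)\<close> is 1-Lipschitz on \<open>t \<ge> 0\<close>, both contributions are integrals of
  \<open>\<bar>\<Phi> - \<Psi>\<bar>\<close> against the prior, the first weighted by \<open>h = exp (- \<Psi>)\<close>, and both are divided by
  \<open>b\<close> (\<open>KL_Gibbs_le\<close>).

  The difference of the two quadratic forms factors as a difference of squares,
  \<open>\<Phi> - \<Psi> = 1/2 * ((G - Gt) \<bullet> A)\<close> with \<open>A = matrix_inv C *v (G + Gt - 2 *\<^sub>R y)\<close>
  (\<open>sq_norm_inv_diff\<close>), and is bounded by \<open>cL / 2 * norm A * norm \<E>\<close>. Hoelder's inequality with
  the three exponents \<open>p, p, q\<close>, where \<open>1/p + 1/p + 1/q = 1\<close>, bounds the weighted integral by
  \<open>cL / 2\<close> times the norms of \<open>A\<close>, \<open>\<E>\<close> and \<open>h\<close> (\<open>Hoelder_three\<close>); for the unweighted one the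
  weight is 1. Since \<open>b\<close> is the \<open>L\<^sup>1\<close> norm of \<open>h\<close>, division by \<open>b\<close> produces the constants
  \<open>c3\<close> and \<open>c2\<close> respectively.

  The bounds on \<open>c3\<close> compare norms of \<open>h\<close>, which takes values in the half-open interval from 0 to
  1: the \<open>L\<^sup>q\<close> norm is at least the \<open>L\<^sup>1\<close> norm (Hoelder with two constant factors 1) and at most 1.
\<close>

section \<open>Hoelder's inequality for two real functions\<close>

lemma integrable_nonneg_le:
  fixes f g :: "'a \<Rightarrow> real"
  assumes "integrable \<nu> f" and "g \<in> borel_measurable \<nu>"
    and "\<And>x. 0 \<le> g x" and "AE x in \<nu>. g x \<le> f x"
  shows "integrable \<nu> g"
  using assms(1,2)
proof (rule Bochner_Integration.integrable_bound)
  show "AE x in \<nu>. norm (g x) \<le> norm (f x)"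
    using assms(4) by eventually_elim (use assms(3) in \<open>simp add: order_trans[OF _ abs_ge_self]\<close>)
qed

text \<open>
  Young's inequality holds pointwise for the functions divided by their norms; integrating it gives
  the claim. If one of the norms vanishes, so does the product almost everywhere.
\<close>

lemma Hoelder_integral:
  fixes f g :: "'a \<Rightarrow> real"
  assumes r: "1 < r" and s: "1 < s" and rs: "1 / r + 1 / s = 1"
    and [measurable]: "f \<in> borel_measurable \<nu>" "g \<in> borel_measurable \<nu>"
    and f0: "\<And>x. 0 \<le> f x" and g0: "\<And>x. 0 \<le> g x"
    and intf: "integrable \<nu> (\<lambda>x. f x powr r)" and intg: "integrable \<nu> (\<lambda>x. g x powr s)"
  shows "integrable \<nu> (\<lambda>x. f x * g x)"
    and "(\<integral>x. f x * g x \<partial>\<nu>) \<le> (\<integral>x. f x powr r \<partial>\<nu>) powr (1 / r) * (\<integral>x. g x powr s \<partial>\<nu>) powr (1 / s)"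
proof -
  have young: "a * b \<le> a powr r / r + b powr s / s" if "0 \<le> a" "0 \<le> b" for a b :: real
    using Youngs_inequality[OF r s rs that] .
  show int: "integrable \<nu> (\<lambda>x. f x * g x)"
    using intf intg young f0 g0
    by (auto intro!: integrable_nonneg_le[of \<nu> "\<lambda>x. f x powr r / r + g x powr s / s"
          "\<lambda>x. f x * g x"])
  define A where "A = (\<integral>x. f x powr r \<partial>\<nu>)"
  define B where "B = (\<integral>x. g x powr s \<partial>\<nu>)"
  have A0: "0 \<le> A" and B0: "0 \<le> B" unfolding A_def B_def by simp_all
  show "(\<integral>x. f x * g x \<partial>\<nu>) \<le> (\<integral>x. f x powr r \<partial>\<nu>) powr (1 / r) * (\<integral>x. g x powr s \<partial>\<nu>) powr (1 / s)"
  proof (cases "A = 0 \<or> B = 0")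
    case True
    have "AE x in \<nu>. f x * g x = 0"
      using True
    proof
      assume "A = 0"
      then have "AE x in \<nu>. f x powr r = 0"
        unfolding A_def using integral_nonneg_eq_0_iff_AE[OF intf] by simp
      then show ?thesis by auto
    next
      assume "B = 0"
      then have "AE x in \<nu>. g x powr s = 0"
        unfolding B_def using integral_nonneg_eq_0_iff_AE[OF intg] by simp
      then show ?thesis by auto
    qed
    then have "(\<integral>x. f x * g x \<partial>\<nu>) = 0" by (rule integral_eq_zero_AE)
    then show ?thesis by simp
  next
    case False
    with A0 B0 have A: "0 < A" and B: "0 < B" by auto
    define a where "a = A powr (1 / r)"
    define b where "b = B powr (1 / s)"
    have a: "0 < a" "a powr r = A" and b: "0 < b" "b powr s = B"
      using A B r s by (auto simp: a_def b_def powr_powr)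
    have pw: "f x * g x \<le> a * b * (f x powr r / (A * r) + g x powr s / (B * s))" for x
    proof -
      have "(f x / a) * (g x / b) \<le> (f x / a) powr r / r + (g x / b) powr s / s"
        using f0 g0 a b by (intro young) (auto intro: divide_nonneg_pos)
      also have "\<dots> = f x powr r / (A * r) + g x powr s / (B * s)"
        using f0 g0 a b by (simp add: powr_divide)
      finally show ?thesis
        using a b by (simp add: field_simps)
    qed
    have "(\<integral>x. f x * g x \<partial>\<nu>) \<le> (\<integral>x. a * b * (f x powr r / (A * r) + g x powr s / (B * s)) \<partial>\<nu>)"
      using int intf intg pw by (intro integral_mono) auto
    also have "\<dots> = a * b * (A / (A * r) + B / (B * s))"
      using intf intg by (simp add: A_def B_def)
    also have "\<dots> = a * b"
      using A B rs by simp
    finally show ?thesis unfolding a_def b_def A_def B_def .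
  qed
qed

section \<open>The spaces \<open>L\<^sup>p\<close> over a probability measure\<close>

lemma integrable_norm_powr:
  assumes "G \<in> Lp_space (ereal r) \<nu>"
  shows "integrable \<nu> (\<lambda>m. norm (G m) powr r)"
  using assms by (simp add: Lp_space_def)

lemma Lp_norm_ereal:
  "Lp_norm (ereal r) \<nu> G = (\<integral>m. norm (G m) powr r \<partial>\<nu>) powr (1 / r)"
  by (simp add: Lp_norm_def)

lemma Lp_norm_1: "Lp_norm 1 \<nu> G = (\<integral>m. norm (G m) \<partial>\<nu>)"
  by (simp add: Lp_norm_def)

lemma Lp_space_measurable: "G \<in> Lp_space p \<nu> \<Longrightarrow> G \<in> borel_measurable \<nu>"
  by (simp add: Lp_space_def)

lemma q_exponent_ge_1:
  assumes "2 \<le> p"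
  shows "1 \<le> q_exponent p"
proof (cases p)
  case (real r)
  have "q_exponent p = ereal (r / (r - 2))" if "r \<noteq> 2"
    using real that by (simp add: q_exponent_def numeral_eq_ereal)
  then show ?thesis
    using real assms by (cases "r = 2") (auto simp: q_exponent_def)
qed (use assms in \<open>auto simp: q_exponent_def\<close>)

context prob_space
begin

text \<open>
  Without any mass the essential supremum would be \<open>- \<infinity>\<close>; on a probability space a lower bound that
  holds almost everywhere passes to it.
\<close>

lemma esssup_norm_nonneg:
  assumes [measurable]: "G \<in> borel_measurable M"
  shows "0 \<le> esssup M (\<lambda>m. ereal (norm (G m)))"
proof -
  have "AE m in M. 0 \<le> esssup M (\<lambda>m. ereal (norm (G m)))"
    using esssup_AE[of "\<lambda>m. ereal (norm (G m))" M]
    by eventually_elim (metis ereal_less_eq(5) norm_ge_zero order_trans)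
  then show ?thesis by simp
qed

lemma AE_norm_le_Lp_norm_infinity:
  assumes G: "G \<in> Lp_space \<infinity> M"
  shows "AE m in M. norm (G m) \<le> Lp_norm \<infinity> M G"
proof -
  define S where "S = esssup M (\<lambda>m. ereal (norm (G m)))"
  have "0 \<le> S" "S < \<infinity>"
    using G esssup_norm_nonneg unfolding S_def Lp_space_def by auto
  then have "S = ereal (real_of_ereal S)"
    by (cases S) auto
  then have S: "S = ereal (Lp_norm \<infinity> M G)"
    by (simp add: Lp_norm_def S_def)
  have "AE m in M. ereal (norm (G m)) \<le> S" unfolding S_def by (rule esssup_AE)
  then show ?thesis unfolding S by simp
qed

lemma Lp_norm_nonneg:
  assumes "G \<in> borel_measurable M"
  shows "0 \<le> Lp_norm p M G"
  using esssup_norm_nonneg[OF assms] by (auto simp: Lp_norm_def real_of_ereal_pos)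

lemma Lp_norm_pos:
  assumes p: "1 \<le> p" and G: "G \<in> Lp_space p M" and nz: "\<not> (AE m in M. G m = 0)"
  shows "0 < Lp_norm p M G"
proof -
  have "Lp_norm p M G \<noteq> 0"
  proof
    assume 0: "Lp_norm p M G = 0"
    have "AE m in M. G m = 0"
    proof (cases p)
      case (real r)
      then have "(\<integral>m. norm (G m) powr r \<partial>M) = 0"
        using 0 by (simp add: Lp_norm_ereal)
      then have "AE m in M. norm (G m) powr r = 0"
        using integral_nonneg_eq_0_iff_AE[OF integrable_norm_powr[OF G[unfolded real]]] by simp
      then show ?thesis by simp
    next
      case PInf
      then show ?thesis
        using AE_norm_le_Lp_norm_infinity[of G] G 0 by auto
    next
      case MInf
      then show ?thesis using p by simp
    qed
    with nz show False by blast
  qed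
  then show ?thesis
    using Lp_norm_nonneg[OF Lp_space_measurable[OF G], of p] by simp
qed

lemma Lp_bounded:
  assumes p: "1 \<le> p" and [measurable]: "G \<in> borel_measurable M"
    and c: "\<And>m. norm (G m) \<le> c"
  shows "G \<in> Lp_space p M" and "Lp_norm p M G \<le> c"
proof -
  have c0: "0 \<le> c" using c[of undefined] norm_ge_zero order_trans by blast
  have "G \<in> Lp_space p M \<and> Lp_norm p M G \<le> c"
  proof (cases p)
    case (real r)
    then have r: "1 \<le> r" using p by simp
    have pw: "norm (G m) powr r \<le> c powr r" for m
      using c r by (intro powr_mono2) auto
    have int: "integrable M (\<lambda>m. norm (G m) powr r)"
      using pw by (intro integrable_const_bound[where B="c powr r"]) auto
    have "(\<integral>m. norm (G m) powr r \<partial>M) \<le> c powr r"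
      using integral_mono[OF int integrable_const[of "c powr r"]] pw by (simp add: prob_space)
    then have "(\<integral>m. norm (G m) powr r \<partial>M) powr (1 / r) \<le> (c powr r) powr (1 / r)"
      using r by (intro powr_mono2) auto
    also have "\<dots> = c" using r c0 by (simp add: powr_powr)
    finally show ?thesis
      using int real by (simp add: Lp_space_def Lp_norm_ereal)
  next
    case PInf
    have le: "esssup M (\<lambda>m. ereal (norm (G m))) \<le> ereal c"
      using c by (intro esssup_I) auto
    then have "esssup M (\<lambda>m. ereal (norm (G m))) < \<infinity>"
      by (rule order_le_less_trans) simp
    moreover have "real_of_ereal (esssup M (\<lambda>m. ereal (norm (G m)))) \<le> c"
      using le c0 esssup_norm_nonneg[of G] by (cases "esssup M (\<lambda>m. ereal (norm (G m)))") auto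
    ultimately show ?thesis
      using PInf by (simp add: Lp_space_def Lp_norm_def)
  next
    case MInf
    then show ?thesis using p by simp
  qed
  then show "G \<in> Lp_space p M" and "Lp_norm p M G \<le> c" by auto
qed

text \<open>
  With two dominating functions this covers both sums of \<open>L\<^sup>p\<close> functions and affine bounds, in
  which the second function is constant.
\<close>

lemma Lp_space_dominated:
  fixes G :: "'a \<Rightarrow> 'b::real_normed_vector" and F :: "'a \<Rightarrow> 'c::real_normed_vector"
    and H :: "'a \<Rightarrow> 'd::real_normed_vector"
  assumes p: "1 \<le> p" and [measurable]: "G \<in> borel_measurable M"
    and F: "F \<in> Lp_space p M" and H: "H \<in> Lp_space p M" and k: "0 \<le> k" "0 \<le> l"
    and le: "AE m in M. norm (G m) \<le> k * norm (F m) + l * norm (H m)"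
  shows "G \<in> Lp_space p M"
proof (cases p)
  case (real r)
  then have r: "1 \<le> r" using p by simp
  have "integrable M (\<lambda>m. norm (G m) powr r)"
  proof (rule integrable_nonneg_le)
    show "integrable M (\<lambda>m. (2 * k) powr r * norm (F m) powr r + (2 * l) powr r * norm (H m) powr r)"
      using integrable_norm_powr[OF F[unfolded real]] integrable_norm_powr[OF H[unfolded real]] by simp
    show "AE m in M. norm (G m) powr r
        \<le> (2 * k) powr r * norm (F m) powr r + (2 * l) powr r * norm (H m) powr r"
      using le
    proof eventually_elim
      case (elim m)
      \<comment> \<open>A sum is at most twice its larger term, which avoids convexity of the power.\<close>
      have "norm (G m) powr r \<le> max (2 * k * norm (F m)) (2 * l * norm (H m)) powr r"
        using elim r by (intro powr_mono2) auto
      also have "\<dots> \<le> (2 * k * norm (F m)) powr r + (2 * l * norm (H m)) powr r"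
        by (auto simp: max_def)
      finally show ?case using k by (simp add: powr_mult)
    qed
  qed auto
  then show ?thesis using real by (simp add: Lp_space_def)
next
  case PInf
  define c where "c = k * Lp_norm \<infinity> M F + l * Lp_norm \<infinity> M H"
  have "AE m in M. ereal (norm (G m)) \<le> ereal c"
    using le AE_norm_le_Lp_norm_infinity[OF F[unfolded PInf]]
      AE_norm_le_Lp_norm_infinity[OF H[unfolded PInf]]
  proof eventually_elim
    case (elim m)
    have "k * norm (F m) \<le> k * Lp_norm \<infinity> M F" "l * norm (H m) \<le> l * Lp_norm \<infinity> M H"
      using elim k by (auto intro: mult_left_mono)
    then show ?case using elim unfolding c_def by simp
  qed
  then have "esssup M (\<lambda>m. ereal (norm (G m))) \<le> ereal c"
    by (intro esssup_I) auto
  then have "esssup M (\<lambda>m. ereal (norm (G m))) < \<infinity>"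
    by (rule order_le_less_trans) simp
  then show ?thesis using PInf by (simp add: Lp_space_def)
next
  case MInf
  then show ?thesis using p by simp
qed

text \<open>
  For finite \<open>p\<close>, Cauchy-Schwarz applied to the powers with exponent \<open>p / 2\<close> shows that the product
  of the norms of \<open>f\<close> and \<open>g\<close> has \<open>L\<^sup>p\<^sup>/\<^sup>2\<close> norm at most the product of their \<open>L\<^sup>p\<close> norms. As
  \<open>q_exponent p\<close> is conjugate to \<open>p / 2\<close>, one more application of Hoelder's inequality pairs this
  product with \<open>h\<close>. At \<open>p = 2\<close> and at \<open>p = \<infinity>\<close> the factors with infinite exponent are instead
  bounded pointwise almost everywhere.
\<close>

lemma Hoelder_three:
  fixes f :: "'a \<Rightarrow> 'b::real_normed_vector" and g :: "'a \<Rightarrow> 'c::real_normed_vector"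
    and h :: "'a \<Rightarrow> 'd::real_normed_vector"
  assumes p: "2 \<le> p" and f: "f \<in> Lp_space p M" and g: "g \<in> Lp_space p M"
    and h: "h \<in> Lp_space (q_exponent p) M"
  shows "integrable M (\<lambda>m. norm (f m) * norm (g m) * norm (h m))" (is ?I)
    and "(\<integral>m. norm (f m) * norm (g m) * norm (h m) \<partial>M)
           \<le> Lp_norm p M f * Lp_norm p M g * Lp_norm (q_exponent p) M h" (is ?B)
proof -
  note [measurable] = Lp_space_measurable[OF f] Lp_space_measurable[OF g] Lp_space_measurable[OF h]
  have fin: "?I \<and> ?B" if real: "p = ereal r" for r
  proof -
    have r: "2 \<le> r" using p real by simp
    have fr: "integrable M (\<lambda>m. (norm (f m) powr (r / 2)) powr 2)"
      and gr: "integrable M (\<lambda>m. (norm (g m) powr (r / 2)) powr 2)"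
      using integrable_norm_powr[OF f[unfolded real]] integrable_norm_powr[OF g[unfolded real]]
      by (simp_all add: powr_powr)
    note CS = Hoelder_integral[of 2 2 "\<lambda>m. norm (f m) powr (r / 2)" M "\<lambda>m. norm (g m) powr (r / 2)",
        OF _ _ _ _ _ _ _ fr gr, simplified powr_powr, simplified, folded powr_mult]
    have int: "integrable M (\<lambda>m. (norm (f m) * norm (g m)) powr (r / 2))"
      using CS(1) by simp
    have "(\<integral>m. (norm (f m) * norm (g m)) powr (r / 2) \<partial>M) powr (2 / r)
        \<le> ((\<integral>m. norm (f m) powr r \<partial>M) powr (1/2) * (\<integral>m. norm (g m) powr r \<partial>M) powr (1/2)) powr (2 / r)"
      using CS(2) r by (intro powr_mono2) (auto simp: powr_mult)
    also have "\<dots> = Lp_norm p M f * Lp_norm p M g"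
      using r by (simp add: powr_mult powr_powr Lp_norm_ereal real)
    finally have fg: "(\<integral>m. (norm (f m) * norm (g m)) powr (r / 2) \<partial>M) powr (2 / r)
        \<le> Lp_norm p M f * Lp_norm p M g" .
    show ?thesis
    proof (cases "r = 2")
      case True
      then have q: "q_exponent p = \<infinity>" by (simp add: q_exponent_def real)
      have int: "integrable M (\<lambda>m. norm (f m) * norm (g m))"
        using int True by simp
      have bd: "AE m in M. norm (f m) * norm (g m) * norm (h m)
          \<le> norm (f m) * norm (g m) * Lp_norm (q_exponent p) M h"
        using AE_norm_le_Lp_norm_infinity[OF h[unfolded q]] unfolding q
        by eventually_elim (auto intro: mult_left_mono)
      have inth: "integrable M (\<lambda>m. norm (f m) * norm (g m) * norm (h m))"
        by (rule integrable_nonneg_le[OF _ _ _ bd]) (use int in auto)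
      have "(\<integral>m. norm (f m) * norm (g m) * norm (h m) \<partial>M)
          \<le> (\<integral>m. norm (f m) * norm (g m) * Lp_norm (q_exponent p) M h \<partial>M)"
        using int inth bd by (intro integral_mono_AE) auto
      also have "\<dots> = (\<integral>m. norm (f m) * norm (g m) \<partial>M) * Lp_norm (q_exponent p) M h"
        by simp
      also have "\<dots> \<le> Lp_norm p M f * Lp_norm p M g * Lp_norm (q_exponent p) M h"
        using fg True by (intro mult_right_mono Lp_norm_nonneg) auto
      finally show ?thesis using inth by simp
    next
      case False
      with r have r2: "2 < r" by simp
      define q where "q = r / (r - 2)"
      have q: "q_exponent p = ereal q"
        using r2 real by (simp add: q_exponent_def q_def numeral_eq_ereal)
      have q1: "1 < q" using r2 by (simp add: q_def)
      have rq: "1 / (r / 2) + 1 / q = 1"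
        using r2 by (simp add: q_def field_simps)
      note HO = Hoelder_integral[of "r / 2" q "\<lambda>m. norm (f m) * norm (g m)" M "\<lambda>m. norm (h m)",
          OF _ q1 rq _ _ _ _ int integrable_norm_powr[OF h[unfolded q]]]
      have inth: "integrable M (\<lambda>m. norm (f m) * norm (g m) * norm (h m))"
        using r2 by (intro HO(1)) auto
      have "(\<integral>m. norm (f m) * norm (g m) * norm (h m) \<partial>M)
          \<le> (\<integral>m. (norm (f m) * norm (g m)) powr (r / 2) \<partial>M) powr (1 / (r / 2))
              * (\<integral>m. norm (h m) powr q \<partial>M) powr (1 / q)"
        using r2 by (intro HO(2)) auto
      also have "\<dots> \<le> Lp_norm p M f * Lp_norm p M g * Lp_norm (q_exponent p) M h"
        unfolding q Lp_norm_ereal[of q] using fg by (intro mult_right_mono) auto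
      finally show ?thesis using inth by simp
    qed
  qed
  have inf: "?I \<and> ?B" if inf: "p = \<infinity>"
  proof -
    have q: "q_exponent p = 1" by (simp add: q_exponent_def inf)
    have inth: "integrable M (\<lambda>m. norm (h m))"
      using h unfolding q by (simp add: Lp_space_def)
    have bd: "AE m in M. norm (f m) * norm (g m) * norm (h m) \<le> Lp_norm p M f * Lp_norm p M g * norm (h m)"
      using AE_norm_le_Lp_norm_infinity[OF f[unfolded inf]] AE_norm_le_Lp_norm_infinity[OF g[unfolded inf]]
      unfolding inf
    proof eventually_elim
      case (elim m)
      have "0 \<le> Lp_norm \<infinity> M f"
        using elim(1) norm_ge_zero order_trans by blast
      with elim show ?case by (intro mult_right_mono mult_mono) auto
    qed
    have int: "integrable M (\<lambda>m. norm (f m) * norm (g m) * norm (h m))"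
      by (rule integrable_nonneg_le[OF _ _ _ bd]) (use inth in auto)
    have "(\<integral>m. norm (f m) * norm (g m) * norm (h m) \<partial>M)
        \<le> (\<integral>m. Lp_norm p M f * Lp_norm p M g * norm (h m) \<partial>M)"
      using int inth bd by (intro integral_mono_AE) auto
    then show ?thesis using int by (simp add: q Lp_norm_1)
  qed
  have "?I \<and> ?B"
    using fin inf p by (cases p) auto
  then show ?I ?B by auto
qed

lemma Hoelder_two:
  fixes f :: "'a \<Rightarrow> 'b::real_normed_vector" and g :: "'a \<Rightarrow> 'c::real_normed_vector"
  assumes p: "2 \<le> p" and f: "f \<in> Lp_space p M" and g: "g \<in> Lp_space p M"
  shows "integrable M (\<lambda>m. norm (f m) * norm (g m))"
    and "(\<integral>m. norm (f m) * norm (g m) \<partial>M) \<le> Lp_norm p M f * Lp_norm p M g"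
proof -
  note one = Lp_bounded[OF q_exponent_ge_1[OF p], of "\<lambda>_. 1 :: real" 1, simplified]
  show "integrable M (\<lambda>m. norm (f m) * norm (g m))"
    using Hoelder_three(1)[OF p f g one(1)] by simp
  have "(\<integral>m. norm (f m) * norm (g m) \<partial>M)
      \<le> Lp_norm p M f * Lp_norm p M g * Lp_norm (q_exponent p) M (\<lambda>_. 1 :: real)"
    using Hoelder_three(2)[OF p f g one(1)] by simp
  also have "\<dots> \<le> Lp_norm p M f * Lp_norm p M g * 1"
    using one(2) Lp_norm_nonneg[OF Lp_space_measurable[OF f]] Lp_norm_nonneg[OF Lp_space_measurable[OF g]]
    by (intro mult_left_mono) auto
  finally show "(\<integral>m. norm (f m) * norm (g m) \<partial>M) \<le> Lp_norm p M f * Lp_norm p M g" by simp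
qed

text \<open>
  The constant function 1 has norm at most 1 for every exponent, so it can fill the two slots with
  exponent \<open>p\<close> in Hoelder's inequality.
\<close>

lemma Lp_norm_1_le_q_exponent:
  assumes p: "2 \<le> p" and h: "h \<in> Lp_space (q_exponent p) M"
  shows "Lp_norm 1 M h \<le> Lp_norm (q_exponent p) M h"
proof -
  have p1: "1 \<le> p" using p order_trans[of 1 2 p] by simp
  note one = Lp_bounded[OF p1, of "\<lambda>_. 1 :: real" 1, simplified]
  have "Lp_norm 1 M h \<le> Lp_norm p M (\<lambda>_. 1 :: real) * Lp_norm p M (\<lambda>_. 1 :: real) * Lp_norm (q_exponent p) M h"
    using Hoelder_three(2)[OF p one(1) one(1) h] by (simp add: Lp_norm_1)
  also have "\<dots> \<le> 1 * 1 * Lp_norm (q_exponent p) M h"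
    using one(2) Lp_norm_nonneg[OF Lp_space_measurable[OF h]]
      Lp_norm_nonneg[OF Lp_space_measurable[OF one(1)]]
    by (intro mult_right_mono mult_mono) auto
  finally show ?thesis by simp
qed

section \<open>The divergence of two Gibbs measures\<close>

text \<open>
  The second integral accounts for the two normalizing constants: it bounds \<open>a - b\<close>, and
  \<open>ln a - ln b \<le> (a - b) / b\<close>. Only the constant of the first argument of the divergence
  therefore ends up in the denominator.
\<close>

lemma KL_Gibbs_le:
  fixes \<Phi> \<Psi> :: "'a \<Rightarrow> real"
  assumes [measurable]: "\<Phi> \<in> borel_measurable M" "\<Psi> \<in> borel_measurable M"
    and \<Phi>0: "\<And>m. 0 \<le> \<Phi> m" and \<Psi>0: "\<And>m. 0 \<le> \<Psi> m"
    and int: "integrable M (\<lambda>m. \<bar>\<Phi> m - \<Psi> m\<bar>)"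
  defines "a \<equiv> \<integral>m. exp (- \<Phi> m) \<partial>M" and "b \<equiv> \<integral>m. exp (- \<Psi> m) \<partial>M"
  defines "\<mu> \<equiv> density M (\<lambda>m. ennreal (exp (- \<Phi> m) / a))"
    and "\<eta> \<equiv> density M (\<lambda>m. ennreal (exp (- \<Psi> m) / b))"
  shows "integrable \<eta> (entropy_density (exp 1) \<mu> \<eta>)"
    and "D_KL \<eta> \<mu> \<le> ((\<integral>m. \<bar>\<Phi> m - \<Psi> m\<bar> * exp (- \<Psi> m) \<partial>M) + (\<integral>m. \<bar>\<Phi> m - \<Psi> m\<bar> \<partial>M)) / b"
proof -
  have ia: "integrable M (\<lambda>m. exp (- \<Phi> m))" and ib: "integrable M (\<lambda>m. exp (- \<Psi> m))"
    using \<Phi>0 \<Psi>0 by (auto intro!: integrable_const_bound[where B=1])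
  have Mnz: "emeasure M (space M) \<noteq> 0" by (simp add: emeasure_space_1)
  have pos: "0 < (\<integral>m. exp (- f m) \<partial>M)" if "integrable M (\<lambda>m. exp (- f m))" for f :: "'a \<Rightarrow> real"
    using integral_less_AE_space[OF integrable_zero that _ Mnz] by simp
  have a: "0 < a" and b: "0 < b" unfolding a_def b_def using pos ia ib by auto
  define d where "d m = \<Phi> m - \<Psi> m + (ln a - ln b)" for m
  have [measurable]: "d \<in> borel_measurable M" unfolding d_def by measurable
  have logd: "log (exp 1) ((exp (- \<Psi> m) / b) / (exp (- \<Phi> m) / a)) = d m" for m
    using a b by (simp add: log_def d_def ln_div ln_mult)
  have [simp]: "sets \<mu> = sets M" "sets \<eta> = sets M" by (simp_all add: \<mu>_def \<eta>_def)
  have \<eta>: "\<eta> = density \<mu> (\<lambda>m. ennreal ((exp (- \<Psi> m) / b) / (exp (- \<Phi> m) / a)))"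
    unfolding \<mu>_def \<eta>_def using a b by (subst density_density_divide) auto
  interpret \<mu>: sigma_finite_measure \<mu>
    unfolding \<mu>_def by (subst sigma_finite_iff_density_finite) auto
  have "AE m in \<mu>. ennreal ((exp (- \<Psi> m) / b) / (exp (- \<Phi> m) / a)) = RN_deriv \<mu> \<eta> m"
    by (rule \<mu>.RN_deriv_unique) (auto simp: \<eta> \<mu>_def)
  then have "AE m in \<mu>. entropy_density (exp 1) \<mu> \<eta> m = d m"
  proof eventually_elim
    case (elim m)
    have "entropy_density (exp 1) \<mu> \<eta> m = log (exp 1) ((exp (- \<Psi> m) / b) / (exp (- \<Phi> m) / a))"
      unfolding entropy_density_def comp_def elim[symmetric] using a b by simp
    then show ?case unfolding logd .
  qed
  then have ae: "AE m in M. entropy_density (exp 1) \<mu> \<eta> m = d m"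
    unfolding \<mu>_def using a by (subst (asm) AE_density) auto
  have ed[measurable]: "entropy_density (exp 1) \<mu> \<eta> \<in> borel_measurable M"
    unfolding measurable_cong_sets[OF \<open>sets \<mu> = sets M\<close>[symmetric] refl]
    by (rule measurable_entropy_density)
  define D where "D m = \<bar>\<Phi> m - \<Psi> m\<bar>" for m
  have [measurable]: "D \<in> borel_measurable M" unfolding D_def by measurable
  have intD: "integrable M D" using int unfolding D_def .
  have intDe: "integrable M (\<lambda>m. D m * exp (- \<Psi> m))"
    using \<Psi>0 by (intro integrable_nonneg_le[OF intD]) (auto simp: D_def mult_left_le)
  have intde: "integrable M (\<lambda>m. (\<Phi> m - \<Psi> m) * exp (- \<Psi> m))"
    by (intro Bochner_Integration.integrable_bound[OF intDe]) (auto simp: D_def abs_mult)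
  have dexp: "exp (- \<Psi> m) / b * d m
      = ((\<Phi> m - \<Psi> m) * exp (- \<Psi> m) + (ln a - ln b) * exp (- \<Psi> m)) / b" for m
    using b by (simp add: d_def field_simps)
  have intd: "integrable M (\<lambda>m. exp (- \<Psi> m) / b * d m)"
    unfolding dexp using intde ib by simp
  have "integrable M (\<lambda>m. exp (- \<Psi> m) / b * entropy_density (exp 1) \<mu> \<eta> m)"
    by (rule integrable_cong_AE_imp[OF intd _ AE_mp[OF ae]]) auto
  then show "integrable \<eta> (entropy_density (exp 1) \<mu> \<eta>)"
    unfolding \<eta>_def[abs_def] using ed b by (subst integrable_real_density) (auto simp: \<eta>_def)
  have "D_KL \<eta> \<mu> = (\<integral>m. exp (- \<Psi> m) / b
      * log (exp 1) ((exp (- \<Psi> m) / b) / (exp (- \<Phi> m) / a)) \<partial>M)"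
    unfolding D_KL_def \<mu>_def \<eta>_def using a b by (intro KL_density_density) auto
  also have "\<dots> = (\<integral>m. exp (- \<Psi> m) / b * d m \<partial>M)"
    unfolding logd ..
  also have "\<dots> = (\<integral>m. (\<Phi> m - \<Psi> m) * exp (- \<Psi> m) \<partial>M) / b + (ln a - ln b)"
    unfolding dexp using intde ib b by (simp add: b_def[symmetric] add_divide_distrib)
  also have "(\<integral>m. (\<Phi> m - \<Psi> m) * exp (- \<Psi> m) \<partial>M) \<le> (\<integral>m. D m * exp (- \<Psi> m) \<partial>M)"
    using intde intDe by (intro integral_mono) (auto simp: D_def)
  also have "ln a - ln b \<le> (a - b) / b"
    using a b by (rule ln_diff_le)
  also have "a - b \<le> (\<integral>m. D m \<partial>M)"
  proof -
    \<comment> \<open>The potentials are nonnegative, and \<open>t \<mapsto> exp (- t)\<close> is 1-Lipschitz for \<open>t \<ge> 0\<close>.\<close>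
    have pw: "exp (- \<Phi> m) - exp (- \<Psi> m) \<le> D m" for m
    proof (cases "\<Phi> m \<le> \<Psi> m")
      case True
      have "1 - exp (- D m) \<le> D m" "0 \<le> D m" "0 \<le> 1 - exp (- D m)"
        using exp_ge_add_one_self[of "- D m"] by (auto simp: D_def)
      moreover have "exp (- \<Phi> m) - exp (- \<Psi> m) = exp (- \<Phi> m) * (1 - exp (- D m))"
        using True by (simp add: D_def algebra_simps flip: exp_add)
      moreover have "exp (- \<Phi> m) * (1 - exp (- D m)) \<le> 1 * (1 - exp (- D m))"
        using \<Phi>0[of m] calculation by (intro mult_right_mono) auto
      ultimately show ?thesis by simp
    next
      case False
      then have "exp (- \<Phi> m) \<le> exp (- \<Psi> m)" by simp
      moreover have "0 \<le> D m" by (simp add: D_def)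
      ultimately show ?thesis by linarith
    qed
    have "a - b = (\<integral>m. exp (- \<Phi> m) - exp (- \<Psi> m) \<partial>M)"
      unfolding a_def b_def using ia ib by simp
    also have "\<dots> \<le> (\<integral>m. D m \<partial>M)"
      using ia ib intD pw by (intro integral_mono) auto
    finally show ?thesis .
  qed
  finally show "D_KL \<eta> \<mu> \<le> ((\<integral>m. \<bar>\<Phi> m - \<Psi> m\<bar> * exp (- \<Psi> m) \<partial>M) + (\<integral>m. \<bar>\<Phi> m - \<Psi> m\<bar> \<partial>M)) / b"
    using b by (simp add: D_def add_divide_distrib divide_right_mono)
qed

end

section \<open>The quadratic form of the inverse covariance\<close>

lemma symmetric_pos_def_invertible:
  assumes "symmetric_pos_def C"
  shows "invertible C"
proof -
  have "x = 0" if "C *v x = 0" for x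
    using assms that unfolding symmetric_pos_def_def by (metis inner_zero_right less_irrefl)
  then show ?thesis
    unfolding invertible_left_inverse matrix_left_invertible_ker by blast
qed

lemma mult_matrix_inv:
  fixes C :: "real^'n^'n"
  assumes "invertible C"
  shows "C *v (matrix_inv C *v x) = x"
proof -
  have "C ** matrix_inv C = mat 1 \<and> matrix_inv C ** C = mat 1"
    unfolding matrix_inv_def using assms unfolding invertible_def by (rule someI_ex)
  then show ?thesis by (simp add: matrix_vector_mul_assoc)
qed

text \<open>
  Substituting \<open>x = C *v u\<close> and \<open>z = C *v w\<close> reduces symmetry of the inverse to symmetry of \<open>C\<close>;
  the same substitution gives nonnegativity of the form in the next lemma.
\<close>

lemma matrix_inv_symmetric:
  assumes "symmetric_pos_def C"
  shows "x \<bullet> (matrix_inv C *v z) = z \<bullet> (matrix_inv C *v x)"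
proof -
  have sym: "(C *v u) \<bullet> w = u \<bullet> (C *v w)" for u w
    using assms dot_lmul_matrix[of u C w] unfolding symmetric_pos_def_def
    by (metis transpose_matrix_vector)
  define u where "u = matrix_inv C *v x"
  define w where "w = matrix_inv C *v z"
  have "C *v u = x" "C *v w = z"
    using symmetric_pos_def_invertible[OF assms] by (simp_all add: u_def w_def mult_matrix_inv)
  then show ?thesis
    using sym[of u w] by (simp add: u_def[symmetric] w_def[symmetric] inner_commute)
qed

lemma sq_norm_inv_nonneg:
  assumes "symmetric_pos_def C"
  shows "0 \<le> sq_norm_inv C x"
proof -
  define u where "u = matrix_inv C *v x"
  have x: "x = C *v u"
    using symmetric_pos_def_invertible[OF assms] by (simp add: u_def mult_matrix_inv)
  have "0 \<le> u \<bullet> (C *v u)"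
    using assms unfolding symmetric_pos_def_def by (cases "u = 0") (auto intro: less_imp_le)
  then show ?thesis
    unfolding sq_norm_inv_def u_def[symmetric] by (simp add: x inner_commute)
qed

text \<open>
  By symmetry the difference of two values of the form factors like a difference of squares,
  \<open>s\<^sup>2 - t\<^sup>2 = (s - t) (s + t)\<close>, with \<open>s = y - u\<close> and \<open>t = y - w\<close>.
\<close>

lemma sq_norm_inv_diff:
  assumes "symmetric_pos_def C"
  shows "sq_norm_inv C (y - u) - sq_norm_inv C (y - w)
    = (u - w) \<bullet> (matrix_inv C *v (u + w - 2 *\<^sub>R y))"
proof -
  have "sq_norm_inv C s - sq_norm_inv C t = (s - t) \<bullet> (matrix_inv C *v (s + t))" for s t
    using matrix_inv_symmetric[OF assms, of s t]
    by (simp add: sq_norm_inv_def matrix_vector_right_distrib inner_diff_left inner_add_right)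
  then have "sq_norm_inv C (y - u) - sq_norm_inv C (y - w)
      = ((y - u) - (y - w)) \<bullet> (matrix_inv C *v ((y - u) + (y - w)))" .
  also have "(y - u) - (y - w) = - (u - w)" by simp
  also have "(y - u) + (y - w) = - (u + w - 2 *\<^sub>R y)" by (simp add: scaleR_2)
  also have "matrix_inv C *v (- (u + w - 2 *\<^sub>R y)) = - (matrix_inv C *v (u + w - 2 *\<^sub>R y))"
    using matrix_vector_mult_scaleR[of "matrix_inv C" "-1" "u + w - 2 *\<^sub>R y"] by simp
  finally show ?thesis by (simp only: inner_minus_left inner_minus_right minus_minus)
qed

lemma matrix_vector_mult_measurable [measurable]:
  "(\<lambda>x. A *v x) \<in> borel_measurable borel" for A :: "real^'n^'m"
  by (intro borel_measurable_continuous_onI linear_continuous_on matrix_vector_mul_bounded_linear)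

lemma sq_norm_inv_measurable [measurable]: "sq_norm_inv C \<in> borel_measurable borel"
  unfolding sq_norm_inv_def[abs_def] by measurable

text \<open>
  The normalization of the Gaussian is a factor of both the likelihood and the evidence. It
  cancels because it is nonzero, \<open>C\<close> being invertible.
\<close>

lemma posterior_eq_density_exp:
  assumes "symmetric_pos_def C"
  shows "posterior \<nu> C G y = density \<nu> (\<lambda>m. ennreal (exp (- (1 / 2 * sq_norm_inv C (y - G m)))
    / (\<integral>m. exp (- (1 / 2 * sq_norm_inv C (y - G m))) \<partial>\<nu>)))"
proof -
  define K where "K = ((2 * pi) ^ CARD('a) * det C) powr (- 1 / 2)"
  have "det C \<noteq> 0"
    using symmetric_pos_def_invertible[OF assms] invertible_det_nz by blast
  then have "K \<noteq> 0" by (simp add: K_def)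
  moreover have "noise_density C x = K * exp (- (1 / 2 * sq_norm_inv C x))" for x
    by (simp add: noise_density_def K_def)
  ultimately show ?thesis
    by (simp add: posterior_def evidence_def likelihood_def)
qed

section \<open>The posterior error bound\<close>

theorem theorem1:
  fixes \<nu>M :: "'m::{real_inner, polish_space} measure"
    and F Ft \<E> :: "'m \<Rightarrow> 'u::{real_inner, polish_space}"
    and B :: "'u \<Rightarrow> real^'n"
    and C :: "real^'n^'n"
    and y :: "real^'n"
    and p :: ereal
    and cB cBt cL :: real
  assumes "prob_space \<nu>M" and "sets \<nu>M = sets borel"
    and "2 \<le> p"
    and "F \<in> Lp_space p \<nu>M" and "Ft \<in> Lp_space p \<nu>M"
    and "\<E> \<in> borel_measurable \<nu>M" and "AE m in \<nu>M. \<E> m = F m - Ft m"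
    and "B \<circ> F \<in> borel_measurable \<nu>M" and "B \<circ> Ft \<in> borel_measurable \<nu>M"
    and "0 < cB" and "0 < cBt" and "0 < cL"
    and "AE m in \<nu>M. norm ((B \<circ> F) m) \<le> cB * norm (F m)"
    and "AE m in \<nu>M. norm ((B \<circ> Ft) m) \<le> cBt * norm (F m)"
    and "AE m in \<nu>M. norm ((B \<circ> F) m - (B \<circ> Ft) m) \<le> cL * norm (\<E> m)"
    and "symmetric_pos_def C"
    and "mutually_absolutely_continuous (posterior \<nu>M C (B \<circ> F) y) \<nu>M"
    and "mutually_absolutely_continuous (posterior \<nu>M C (B \<circ> Ft) y) \<nu>M"
    and "mutually_absolutely_continuous (posterior \<nu>M C (B \<circ> Ft) y) (posterior \<nu>M C (B \<circ> F) y)"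
  shows "integrable (posterior \<nu>M C (B \<circ> Ft) y)
           (entropy_density (exp 1) (posterior \<nu>M C (B \<circ> F) y) (posterior \<nu>M C (B \<circ> Ft) y))
       \<and> D_KL (posterior \<nu>M C (B \<circ> Ft) y) (posterior \<nu>M C (B \<circ> F) y)
           \<le> c_BIP \<nu>M C (B \<circ> F) (B \<circ> Ft) y cL p * Lp_norm p \<nu>M \<E>
       \<and> (\<lambda>m. matrix_inv C *v ((B \<circ> F) m + (B \<circ> Ft) m - 2 *\<^sub>R y)) \<in> Lp_space p \<nu>M
       \<and> (\<not> (AE m in \<nu>M. (B \<circ> F) m + (B \<circ> Ft) m = 2 *\<^sub>R y)
           \<longrightarrow> 0 < c1 \<nu>M C (B \<circ> F) (B \<circ> Ft) y p)
       \<and> (\<forall>s\<ge>1. 0 < c2 \<nu>M C (B \<circ> Ft) y s)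
       \<and> 0 < c3 \<nu>M C (B \<circ> Ft) y p
       \<and> c3 \<nu>M C (B \<circ> Ft) y p \<in> {1..c2 \<nu>M C (B \<circ> Ft) y 1}"
proof -
  interpret \<nu>M: prob_space \<nu>M by fact
  define G where "G = B \<circ> F"
  define Gt where "Gt = B \<circ> Ft"
  define A where "A m = matrix_inv C *v (G m + Gt m - 2 *\<^sub>R y)" for m
  define \<Phi> where "\<Phi> m = 1 / 2 * sq_norm_inv C (y - G m)" for m
  define \<Psi> where "\<Psi> m = 1 / 2 * sq_norm_inv C (y - Gt m)" for m
  define h where "h m = exp (- \<Psi> m)" for m
  have [measurable]: "G \<in> borel_measurable \<nu>M" "Gt \<in> borel_measurable \<nu>M"
    and E_meas [measurable]: "\<E> \<in> borel_measurable \<nu>M"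
    using assms(6,8,9) by (simp_all add: G_def Gt_def)
  have A_meas [measurable]: "A \<in> borel_measurable \<nu>M"
    unfolding A_def by measurable
  have [measurable]: "\<Phi> \<in> borel_measurable \<nu>M" "\<Psi> \<in> borel_measurable \<nu>M" "h \<in> borel_measurable \<nu>M"
    unfolding \<Phi>_def \<Psi>_def h_def by measurable
  have C: "symmetric_pos_def C" by fact
  have p: "2 \<le> p" by fact
  then have p1: "1 \<le> p" using order_trans[of 1 2 p] by simp
  note q1 = q_exponent_ge_1[OF p]

  have E_Lp: "\<E> \<in> Lp_space p \<nu>M"
  proof (rule \<nu>M.Lp_space_dominated[OF p1 E_meas \<open>F \<in> _\<close> \<open>Ft \<in> _\<close>, of 1 1])
    show "AE m in \<nu>M. norm (\<E> m) \<le> 1 * norm (F m) + 1 * norm (Ft m)"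
      using assms(7) by eventually_elim (simp add: norm_triangle_ineq4)
  qed auto

  \<comment> \<open>Both observables are controlled by \<open>F\<close>, and \<open>y\<close> contributes a constant.\<close>
  have A_Lp: "A \<in> Lp_space p \<nu>M"
  proof -
    obtain K where K: "0 < K" "\<And>x. norm (matrix_inv C *v x) \<le> norm x * K"
      using bounded_linear.pos_bounded[OF matrix_vector_mul_bounded_linear[of "matrix_inv C"]] by blast
    have one: "(\<lambda>_. 1 :: real) \<in> Lp_space p \<nu>M"
      by (rule \<nu>M.Lp_bounded(1)[OF p1, of _ 1]) auto
    show ?thesis
    proof (rule \<nu>M.Lp_space_dominated[OF p1 A_meas \<open>F \<in> _\<close> one, of "(cB + cBt) * K" "2 * norm y * K"])
      show "AE m in \<nu>M. norm (A m) \<le> (cB + cBt) * K * norm (F m) + 2 * norm y * K * norm (1 :: real)"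
        using assms(13,14)
      proof eventually_elim
        case (elim m)
        have "norm (G m + Gt m - 2 *\<^sub>R y) \<le> norm (G m) + norm (Gt m) + 2 * norm y"
          using norm_triangle_ineq4[of "G m + Gt m" "2 *\<^sub>R y"] norm_triangle_ineq[of "G m" "Gt m"] by simp
        also have "\<dots> \<le> (cB + cBt) * norm (F m) + 2 * norm y"
          using elim by (simp add: G_def Gt_def algebra_simps)
        finally have "norm (G m + Gt m - 2 *\<^sub>R y) * K \<le> ((cB + cBt) * norm (F m) + 2 * norm y) * K"
          using K(1) by (intro mult_right_mono) auto
        then show ?case
          using K(2)[of "G m + Gt m - 2 *\<^sub>R y"] by (simp add: A_def algebra_simps)
      qed
    qed (use K(1) assms(10,11) in auto)
  qed

  have \<Phi>0: "0 \<le> \<Phi> m" and \<Psi>0: "0 \<le> \<Psi> m" for m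
    using sq_norm_inv_nonneg[OF C] by (simp_all add: \<Phi>_def \<Psi>_def)
  have h01: "0 < h m" "norm (h m) \<le> 1" for m
    using \<Psi>0[of m] by (simp_all add: h_def)
  have h_Lp: "h \<in> Lp_space s \<nu>M" and h_le: "Lp_norm s \<nu>M h \<le> 1" if "1 \<le> s" for s
    using \<nu>M.Lp_bounded[OF that _ h01(2)] by auto
  have h_nz: "\<not> (AE m in \<nu>M. h m = 0)"
    by (simp add: h_def)
  have h_pos: "0 < Lp_norm s \<nu>M h" if "1 \<le> s" for s
    using \<nu>M.Lp_norm_pos[OF that h_Lp[OF that] h_nz] .
  have c2: "c2 \<nu>M C Gt y s = inverse (Lp_norm s \<nu>M h)" for s
    by (simp add: c2_def h_def[abs_def] \<Psi>_def)
  define Z where "Z = Lp_norm 1 \<nu>M h"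
  define H where "H = Lp_norm (q_exponent p) \<nu>M h"
  have Z: "0 < Z" "Z \<le> H" and H: "0 < H" "H \<le> 1"
    using h_pos[of 1] h_pos[OF q1] h_le[OF q1] \<nu>M.Lp_norm_1_le_q_exponent[OF p h_Lp[OF q1]]
    by (auto simp: Z_def H_def)
  have Z_eq: "Z = (\<integral>m. exp (- \<Psi> m) \<partial>\<nu>M)"
    by (simp add: Z_def Lp_norm_1 h_def)
  have c3: "c3 \<nu>M C Gt y p = H / Z"
    by (simp add: c3_def c2 Z_def H_def field_simps)

  define N where "N = Lp_norm p \<nu>M A * Lp_norm p \<nu>M \<E>"
  have c1: "c1 \<nu>M C G Gt y p = 1 / 2 * Lp_norm p \<nu>M A"
    by (simp add: c1_def A_def[abs_def])
  have diff: "AE m in \<nu>M. \<bar>\<Phi> m - \<Psi> m\<bar> \<le> cL / 2 * (norm (A m) * norm (\<E> m))"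
    using assms(15)
  proof eventually_elim
    case (elim m)
    have eq: "\<Phi> m - \<Psi> m = 1 / 2 * ((G m - Gt m) \<bullet> A m)"
      unfolding \<Phi>_def \<Psi>_def A_def sq_norm_inv_diff[OF C, symmetric] by simp
    have "\<bar>\<Phi> m - \<Psi> m\<bar> \<le> 1 / 2 * (norm (G m - Gt m) * norm (A m))"
      unfolding eq using Cauchy_Schwarz_ineq2[of "G m - Gt m" "A m"] by (simp add: abs_mult)
    also have "\<dots> \<le> 1 / 2 * (cL * norm (\<E> m) * norm (A m))"
      using elim by (intro mult_left_mono mult_right_mono) (auto simp: G_def Gt_def)
    finally show ?case by (simp add: mult_ac)
  qed
  have diffh: "AE m in \<nu>M. \<bar>\<Phi> m - \<Psi> m\<bar> * exp (- \<Psi> m) \<le> cL / 2 * (norm (A m) * norm (\<E> m) * norm (h m))"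
    using diff
  proof eventually_elim
    case (elim m)
    then have "\<bar>\<Phi> m - \<Psi> m\<bar> * h m \<le> cL / 2 * (norm (A m) * norm (\<E> m)) * h m"
      using h01(1)[of m] by (intro mult_right_mono) auto
    then show ?case using h01(1)[of m] by (simp add: h_def mult_ac)
  qed
  note H2 = \<nu>M.Hoelder_two[OF p A_Lp E_Lp]
  note H3 = \<nu>M.Hoelder_three[OF p A_Lp E_Lp h_Lp[OF q1]]
  have int: "integrable \<nu>M (\<lambda>m. \<bar>\<Phi> m - \<Psi> m\<bar>)"
    by (rule integrable_nonneg_le[OF _ _ _ diff]) (use H2(1) in auto)
  have inth: "integrable \<nu>M (\<lambda>m. \<bar>\<Phi> m - \<Psi> m\<bar> * exp (- \<Psi> m))"
    by (rule integrable_nonneg_le[OF _ _ _ diffh]) (use H3(1) in auto)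
  have cL: "0 \<le> cL / 2" using assms(12) by simp
  have "(\<integral>m. \<bar>\<Phi> m - \<Psi> m\<bar> \<partial>\<nu>M) \<le> (\<integral>m. cL / 2 * (norm (A m) * norm (\<E> m)) \<partial>\<nu>M)"
    using int H2(1) diff by (intro integral_mono_AE) auto
  also have "\<dots> \<le> cL / 2 * N"
    using mult_left_mono[OF H2(2) cL] by (simp add: N_def)
  finally have I1: "(\<integral>m. \<bar>\<Phi> m - \<Psi> m\<bar> \<partial>\<nu>M) \<le> cL / 2 * N" .
  have "(\<integral>m. \<bar>\<Phi> m - \<Psi> m\<bar> * exp (- \<Psi> m) \<partial>\<nu>M)
      \<le> (\<integral>m. cL / 2 * (norm (A m) * norm (\<E> m) * norm (h m)) \<partial>\<nu>M)"
    using inth H3(1) diffh by (intro integral_mono_AE) auto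
  also have "\<dots> \<le> cL / 2 * (N * H)"
    using mult_left_mono[OF H3(2) cL] by (simp add: N_def H_def)
  finally have I2: "(\<integral>m. \<bar>\<Phi> m - \<Psi> m\<bar> * exp (- \<Psi> m) \<partial>\<nu>M) \<le> cL / 2 * (N * H)" .

  note KL = \<nu>M.KL_Gibbs_le[OF _ _ \<Phi>0 \<Psi>0 int, folded Z_eq]
  have post: "posterior \<nu>M C G y = density \<nu>M (\<lambda>m. ennreal (exp (- \<Phi> m) / (\<integral>m. exp (- \<Phi> m) \<partial>\<nu>M)))"
    "posterior \<nu>M C Gt y = density \<nu>M (\<lambda>m. ennreal (exp (- \<Psi> m) / Z))"
    unfolding Z_eq \<Phi>_def \<Psi>_def by (rule posterior_eq_density_exp[OF C])+
  have ent: "integrable (posterior \<nu>M C Gt y)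
      (entropy_density (exp 1) (posterior \<nu>M C G y) (posterior \<nu>M C Gt y))"
    unfolding post by (rule KL(1)) measurable
  have "D_KL (posterior \<nu>M C Gt y) (posterior \<nu>M C G y)
      \<le> ((\<integral>m. \<bar>\<Phi> m - \<Psi> m\<bar> * exp (- \<Psi> m) \<partial>\<nu>M) + (\<integral>m. \<bar>\<Phi> m - \<Psi> m\<bar> \<partial>\<nu>M)) / Z"
    unfolding post by (rule KL(2)) measurable
  also have "\<dots> \<le> (cL / 2 * (N * H) + cL / 2 * N) / Z"
    using I1 I2 Z by (intro divide_right_mono add_mono) auto
  also have "\<dots> = c_BIP \<nu>M C G Gt y cL p * Lp_norm p \<nu>M \<E>"
    unfolding c_BIP_def c1 c3 c2 using Z by (simp add: N_def Z_def[symmetric] field_simps)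
  finally have bound: "D_KL (posterior \<nu>M C Gt y) (posterior \<nu>M C G y)
      \<le> c_BIP \<nu>M C G Gt y cL p * Lp_norm p \<nu>M \<E>" .

  have c1_pos: "0 < c1 \<nu>M C G Gt y p" if nz: "\<not> (AE m in \<nu>M. G m + Gt m = 2 *\<^sub>R y)"
  proof -
    have A0: "A m = 0 \<Longrightarrow> G m + Gt m = 2 *\<^sub>R y" for m
      using mult_matrix_inv[OF symmetric_pos_def_invertible[OF C], of "G m + Gt m - 2 *\<^sub>R y"]
      by (simp add: A_def)
    have "AE m in \<nu>M. G m + Gt m = 2 *\<^sub>R y" if "AE m in \<nu>M. A m = 0"
      using that by eventually_elim (rule A0)
    then have "\<not> (AE m in \<nu>M. A m = 0)"
      using nz by blast
    then show ?thesis
      using \<nu>M.Lp_norm_pos[OF p1 A_Lp] by (simp add: c1)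
  qed
  have "\<forall>s\<ge>1. 0 < c2 \<nu>M C Gt y s"
    using h_pos by (simp add: c2)
  moreover have "0 < c3 \<nu>M C Gt y p" "c3 \<nu>M C Gt y p \<in> {1..c2 \<nu>M C Gt y 1}"
    using Z H by (auto simp: c3 c2 Z_def[symmetric] field_simps)
  ultimately show ?thesis
    using ent bound A_Lp c1_pos unfolding G_def[symmetric] Gt_def[symmetric] A_def[abs_def] by blast
qed

end
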